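(* Let $f:\mathbb{R}^M\to\mathbb{R}$ be a black-box regression function possessing derivatives of arbitrary order. Let $(\bm{x}^t,y^t)\in\mathbb{R}^M\times\mathbb{R}$ be a test sample, let $\bm{x}^{t[1]},\ldots,\bm{x}^{t[N_s]}\in\mathbb{R}^M$ be the sample points randomly populated in the vicinity of $\bm{x}^t$ (their choice not depending on $y^t$), and let $\nu$ be the $\ell_1$ regularization strength. Then LIME applied to the deviation function $F(\bm{x},y)=f(\bm{x})-y$ is deviation-agnostic: for every $i\in\{1,\ldots,M\}$, $$\mathrm{LIME}_i(\bm{x}^t,y^t)=\mathrm{LIME}_i(\bm{x}^t),$$ where the right-hand side is the LIME score of $f$ itself, which does not involve $y^t$.
   Context: An anomaly attribution method $A$, which assigns to each black-box regression function $f$, test sample $(\bm{x}^t,y^t)$ and input-variable index $i$ a score $A_{f,i}(\bm{x}^t,y^t)$, is called deviation-agnostic if for any $f$, $(\bm{x}^t,y^t)$, deviation $\Delta\in\mathbb{R}$ and $i$ one has $A_{f,i}(\bm{x}^t,y^t)=A_{f,i}(\bm{x}^t,y^t+\Delta)$. LIME score for the deviation: put $z^{t[n]}=f(\bm{x}^{t[n]})-y^t$ for $n=1,\ldots,N_s$, and fit the linear model $z=\beta_0+\bm{\beta}^\top\bm{x}$ to the data $\{(\bm{x}^{t[n]},z^{t[n]})\}_{n=1}^{N_s}$ by minimizing over $(\bm{\beta},\beta_0)\in\mathbb{R}^M\times\mathbb{R}$ the lasso objective $$\Psi(\bm{\beta},\beta_0)=\frac{1}{N_s}\sum_{n=1}^{N_s}\bigl(z^{t[n]}-\beta_0-\bm{\beta}^\top\bm{x}^{t[n]}\bigr)^2+\nu\|\bm{\beta}\|_1,$$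 in which the intercept $\beta_0$ is not penalized. The score $\mathrm{LIME}_i(\bm{x}^t,y^t)$ is $\beta_i$, the $i$-th component of the minimizing vector $\bm{\beta}$. The score $\mathrm{LIME}_i(\bm{x}^t)$ is defined in the same way, with the same sample points and the same $\nu$, but with $f(\bm{x}^{t[n]})$ in place of $z^{t[n]}$. *)

theory Defs
  imports "HOL-Analysis.Analysis"
begin

text \<open>Differentiability to a given order, via directional derivatives of the Frechet derivative;
  a function has derivatives of arbitrary order if it is differentiable to every order.\<close>

primrec differentiable_to_order ::
  "nat \<Rightarrow> ('a::real_normed_vector \<Rightarrow> 'b::real_normed_vector) \<Rightarrow> bool" where
  "differentiable_to_order 0 f \<longleftrightarrow> continuous_on UNIV f"
| "differentiable_to_order (Suc k) f \<longleftrightarrow>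
     (\<forall>x. f differentiable (at x)) \<and>
     (\<forall>v. differentiable_to_order k (\<lambda>x. frechet_derivative f (at x) v))"

definition smooth :: "('a::real_normed_vector \<Rightarrow> 'b::real_normed_vector) \<Rightarrow> bool" where
  "smooth f \<longleftrightarrow> (\<forall>k. differentiable_to_order k f)"

definition deviation_agnostic ::
  "((real^'m \<Rightarrow> real) \<Rightarrow> real^'m \<Rightarrow> real \<Rightarrow> 'm \<Rightarrow> real) \<Rightarrow> bool" where
  "deviation_agnostic A \<longleftrightarrow> (\<forall>f x y \<Delta> i. A f x y i = A f x (y + \<Delta>) i)"

definition deviation :: "(real^'m \<Rightarrow> real) \<Rightarrow> real^'m \<Rightarrow> real \<Rightarrow> real" where
  "deviation f x y = f x - y"

definition l1_norm :: "real^'m \<Rightarrow> real" where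
  "l1_norm b = (\<Sum>i\<in>UNIV. \<bar>b $ i\<bar>)"

text \<open>The argument pair is \<open>(\<beta>, \<beta>\<^sub>0)\<close>; the data points are \<open>(X n, z n)\<close> for \<open>n = 1, \<dots>, N\<close>.\<close>

definition lasso_objective ::
  "nat \<Rightarrow> real \<Rightarrow> (nat \<Rightarrow> real^'m) \<Rightarrow> (nat \<Rightarrow> real) \<Rightarrow> (real^'m) \<times> real \<Rightarrow> real" where
  "lasso_objective N \<nu> X z = (\<lambda>(b, b0).
     1 / real N * (\<Sum>n=1..N. (z n - b0 - b \<bullet> X n)\<^sup>2) + \<nu> * l1_norm b)"

definition lasso_coefficients ::
  "nat \<Rightarrow> real \<Rightarrow> (nat \<Rightarrow> real^'m) \<Rightarrow> (nat \<Rightarrow> real) \<Rightarrow> (real^'m) set" where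
  "lasso_coefficients N \<nu> X z =
     {b. \<exists>b0. is_arg_min (lasso_objective N \<nu> X z) (\<lambda>_. True) (b, b0)}"

text \<open>The lasso minimizer need not be unique. A tie-breaking rule picks one vector out of every
  nonempty set of coefficient vectors; if the minimizing vector is unique, every rule picks it.\<close>

definition tie_breaking_rule :: "((real^'m) set \<Rightarrow> real^'m) \<Rightarrow> bool" where
  "tie_breaking_rule sel \<longleftrightarrow> (\<forall>B. B \<noteq> {} \<longrightarrow> sel B \<in> B)"

definition lime_fit ::
  "((real^'m) set \<Rightarrow> real^'m) \<Rightarrow> nat \<Rightarrow> real \<Rightarrow> (nat \<Rightarrow> real^'m) \<Rightarrow> (real^'m \<Rightarrow> real) \<Rightarrow> real^'m" where
  "lime_fit sel N \<nu> X g = sel (lasso_coefficients N \<nu> X (\<lambda>n. g (X n)))"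

text \<open>\<open>S x n\<close> is the \<open>n\<close>-th sample point drawn around the test input \<open>x\<close>.\<close>

definition LIME ::
  "((real^'m) set \<Rightarrow> real^'m) \<Rightarrow> nat \<Rightarrow> real \<Rightarrow> (real^'m \<Rightarrow> nat \<Rightarrow> real^'m) \<Rightarrow>
   (real^'m \<Rightarrow> real) \<Rightarrow> real^'m \<Rightarrow> 'm \<Rightarrow> real" where
  "LIME sel N \<nu> S f x i = lime_fit sel N \<nu> (S x) f $ i"

definition LIME_deviation ::
  "((real^'m) set \<Rightarrow> real^'m) \<Rightarrow> nat \<Rightarrow> real \<Rightarrow> (real^'m \<Rightarrow> nat \<Rightarrow> real^'m) \<Rightarrow>
   (real^'m \<Rightarrow> real) \<Rightarrow> real^'m \<Rightarrow> real \<Rightarrow> 'm \<Rightarrow> real" where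
  "LIME_deviation sel N \<nu> S f x y i = lime_fit sel N \<nu> (S x) (\<lambda>x'. deviation f x' y) $ i"

end

theory Submission
  imports Defs
begin

text \<open>Each residual regroups, \<open>c\<close> joining the intercept, and the penalty does not
  see the intercept.\<close>

lemma lasso_objective_shift:
  "lasso_objective N \<nu> X (\<lambda>n. z n - c) (b, b0) = lasso_objective N \<nu> X z (b, b0 + c)"
  by (simp add: lasso_objective_def algebra_simps)

text \<open>The unpenalized intercept absorbs a constant shift of the responses: \<open>b0 \<mapsto> b0 + c\<close> is a
  bijection that carries one objective to the other and leaves the coefficients alone.\<close>

lemma lasso_coefficients_shift:
  "lasso_coefficients N \<nu> X (\<lambda>n. z n - c) = lasso_coefficients N \<nu> X z"
proof -
  \<comment> \<open>Translation by \<open>c\<close> is onto: any value is reached from itself minus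
    \<open>c\<close>.\<close>
  have shift_all: "(\<forall>b0. P (b0 + c)) \<longleftrightarrow> (\<forall>b0. P b0)" for P :: "real \<Rightarrow> bool"
    by (metis diff_add_cancel)
  have shift_ex: "(\<exists>b0. P (b0 + c)) \<longleftrightarrow> (\<exists>b0. P b0)" for P :: "real \<Rightarrow> bool"
    by (metis diff_add_cancel)
  let ?L = "lasso_objective N \<nu> X z"
  have "is_arg_min (lasso_objective N \<nu> X (\<lambda>n. z n - c)) (\<lambda>_. True) (b, b0) \<longleftrightarrow>
      is_arg_min ?L (\<lambda>_. True) (b, b0 + c)" for b b0
    \<comment> \<open>The competing coefficient vector is left open; only the competitor's intercept
      is re-indexed.\<close>
    using shift_all[of "\<lambda>b1. \<not> ?L (_, b1) < ?L (b, b0 + c)"]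
    by (simp add: is_arg_min_def lasso_objective_shift)
  then show ?thesis
    using shift_ex[of "\<lambda>b0. is_arg_min ?L (\<lambda>_. True) (_, b0)"]
    by (simp add: lasso_coefficients_def)
qed

text \<open>With \<open>y\<close> fixed, the deviation shifts all responses by the same constant. As
  whole sets of minimizing vectors agree, \<open>sel\<close> returns the same vector even under
  ties.\<close>

lemma LIME_deviation_eq_LIME: "LIME_deviation sel N \<nu> S f x y i = LIME sel N \<nu> S f x i"
  by (simp add: LIME_deviation_def LIME_def lime_fit_def deviation_def lasso_coefficients_shift)

theorem theorem1:
  fixes f :: "real^'m \<Rightarrow> real" and x :: "real^'m" and y \<nu> :: real and N :: nat
    and S :: "real^'m \<Rightarrow> nat \<Rightarrow> real^'m"
    and sel :: "(real^'m) set \<Rightarrow> real^'m"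
  assumes "smooth f" and "N \<ge> 1" and "\<nu> \<ge> 0" and "tie_breaking_rule sel"
  shows "deviation_agnostic (LIME_deviation sel N \<nu> S)
    \<and> (\<forall>i. LIME_deviation sel N \<nu> S f x y i = LIME sel N \<nu> S f x i)"
  \<comment> \<open>The scores at \<open>y\<close> and \<open>y + \<Delta>\<close> both equal the
    \<open>LIME\<close> score, which is free of \<open>y\<close>.\<close>
  by (simp add: deviation_agnostic_def LIME_deviation_eq_LIME)

end
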